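(* Let $p\in(0,1)$ and let $P_t(x)$, $t\in\mathbb{Z}_{\ge 0}$, $x\in\mathbb{Z}$, be the marginal distribution $P_t(x)=P_t(x,+1)+P_t(x,-1)$, where $P_t(x,d)$ is the solution of $$P_{t+1}(x,d)=p\,P_t(x-d,d)+(1-p)\,P_t(x,-d),\qquad P_0(x,+1)=P_0(x,-1)=\tfrac12\delta_{x0},$$ for $x\in\mathbb{Z}$, $d\in\{-1,+1\}$, $t\in\mathbb{Z}_{\ge0}$. Then for every integer $n\ge 1$ the following holds. (a) If $p\neq\frac12$, then, with $y=\dfrac{2p^2}{1-2p}+1$, $$P_{2n+1}(2j)=(1-p)\,p^{2j}(1-2p)^{n-j}\,P_{n-j}^{(2j,0)}(y),\qquad 0\le j\le n,$$ $$P_{2n}(2j)=(1-p)^2\,p^{2j}(1-2p)^{n-j-1}\,\frac{n}{n-j}\,P_{n-j-1}^{(2j,1)}(y),\qquad 0\le j\le n-1,$$ $$P_{2n}(2j+1)=(1-p)\,p^{2j+1}(1-2p)^{n-j-1}\,P_{n-j-1}^{(2j+1,0)}(y),\qquad 0\le j\le n-1,$$ $$P_{2n+1}(2j+1)=(1-p)^2\,p^{2j+1}(1-2p)^{n-j-1}\,\frac{n+\frac12}{n-j}\,P_{n-j-1}^{(2j+1,1)}(y),\qquad 0\le j\le n-1.$$ (b) For all $p\in(0,1)$: $P_n(n)=\frac12p^n$, and $P_t(-x)=P_t(x)$ for all $t\in\mathbb{Z}_{\ge0}$ and $x\in\mathbb{Z}$. (c) For $p=\frac12$, the four formulas corresponding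 to those in (a) are $$P_{2n+1}(2j)=2^{-2n}\binom{2n}{n+j},\qquad 0\le j\le n,$$ $$P_{2n}(2j)=2^{-2n}\binom{2n}{n+j},\qquad 0\le j\le n-1,$$ $$P_{2n}(2j+1)=2^{-2n+1}\binom{2n-1}{n+j},\qquad 0\le j\le n-1,$$ $$P_{2n+1}(2j+1)=2^{-2n-1}\binom{2n+1}{n+j+1},\qquad 0\le j\le n-1.$$
   Context: $P_t(x,d)=\mathrm{Prob}(X_t=x;\Delta_t=d)$ is the joint distribution of the two-dimensional Markov chain $(X_t,\Delta_t)$ with values in $\mathbb{Z}\times\{-1,+1\}$ whose transitions are: with probability $p$, $X_{t+1}=X_t+\Delta_t$ and $\Delta_{t+1}=\Delta_t$; with probability $1-p$, $X_{t+1}=X_t$ and $\Delta_{t+1}=-\Delta_t$; the initial state is $X_0=0$ with $\Delta_0=\pm1$ equiprobable. $\delta_{x0}$ is the Kronecker delta. $\binom{n}{k}=\frac{n!}{k!(n-k)!}$ are the binomial coefficients. $P_m^{(\alpha,\beta)}(y)$ (with a superscript pair) denotes the Jacobi polynomial of degree $m$, normalized by $$P_m^{(\alpha,\beta)}(y)=\frac{(\alpha+1)^{\overline{m}}}{m!}\;{}_2F_1\!\left(-m,\,1+\alpha+\beta+m;\,\alpha+1;\,\tfrac{1-y}{2}\right),$$ where $a^{\overline{m}}=a(a+1)\cdots(a+m-1)$ is the rising factorial and ${}_2F_1$ is the Gauss hypergeometric function.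
   Formalization: In (c) each of the four right-hand sides is halved (prefactors 2^{-2n-1}, 2^{-2n-1}, 2^{-2n}, 2^{-2n-2}); as printed they are twice the true values, e.g. for p=1/2 the recurrence gives P_2(0)=1/4, not 1/2. *)

theory Defs
  imports "HOL-Analysis.Analysis"
begin

text \<open>
  \<open>P t x d\<close> is the probability that the walker is at site \<open>x\<close> with direction \<open>d\<close> at time \<open>t\<close>.
  Directions are the integers \<open>-1\<close> and \<open>1\<close>; nothing is required of \<open>P t x d\<close> for other \<open>d\<close>.
\<close>

definition walk_distribution :: "real \<Rightarrow> (nat \<Rightarrow> int \<Rightarrow> int \<Rightarrow> real) \<Rightarrow> bool" where
  "walk_distribution p P \<longleftrightarrow>
     (\<forall>x. \<forall>d\<in>{-1, 1}. P 0 x d = 1/2 * (if x = 0 then 1 else 0)) \<and>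
     (\<forall>t x. \<forall>d\<in>{-1, 1}. P (Suc t) x d = p * P t (x - d) d + (1 - p) * P t x (- d))"

definition marginal :: "(nat \<Rightarrow> int \<Rightarrow> int \<Rightarrow> real) \<Rightarrow> nat \<Rightarrow> int \<Rightarrow> real" where
  "marginal P t x = P t x 1 + P t x (- 1)"

text \<open>
  The series is used below only where it terminates (\<open>a\<close> a nonpositive integer, \<open>c > 0\<close>), so
  its value is meaningful for every real \<open>z\<close>, also outside the unit disc.
\<close>

definition gauss_2F1 :: "real \<Rightarrow> real \<Rightarrow> real \<Rightarrow> real \<Rightarrow> real" where
  "gauss_2F1 a b c z =
     (\<Sum>k. pochhammer a k * pochhammer b k / pochhammer c k * z ^ k / fact k)"

definition jacobi_poly :: "nat \<Rightarrow> real \<Rightarrow> real \<Rightarrow> real \<Rightarrow> real" where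
  "jacobi_poly m \<alpha> \<beta> y =
     pochhammer (\<alpha> + 1) m / fact m *
     gauss_2F1 (- real m) (1 + \<alpha> + \<beta> + real m) (\<alpha> + 1) ((1 - y) / 2)"

primrec walk :: "real \<Rightarrow> nat \<Rightarrow> int \<Rightarrow> int \<Rightarrow> real" where
  "walk p 0 x d = 1/2 * (if x = 0 then 1 else 0)"
| "walk p (Suc t) x d = p * walk p t (x - d) d + (1 - p) * walk p t x (- d)"

lemma walk_distribution_walk: "walk_distribution p (walk p)"
  by (simp add: walk_distribution_def)

text \<open>
  For \<open>p = 1/2\<close> the source prints the four closed forms with prefactors
  \<open>2 powi (- 2 * n)\<close>, \<open>2 powi (- 2 * n)\<close>, \<open>2 powi (- 2 * n + 1)\<close>, \<open>2 powi (- 2 * n - 1)\<close>.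
  These are too large by a factor 2: at \<open>n = 1\<close>, \<open>j = 0\<close> the printed values of
  \<open>P\<^sub>3(0)\<close>, \<open>P\<^sub>2(0)\<close>, \<open>P\<^sub>2(1)\<close>, \<open>P\<^sub>3(1)\<close> are \<open>1/2\<close>, \<open>1/2\<close>, \<open>1/2\<close>, \<open>3/8\<close>, whereas
  the recurrence gives the values below. The theorem is stated with each prefactor halved,
  which is also what the limit \<open>p \<longrightarrow> 1/2\<close> of the general formulas yields.
\<close>

lemma half_values:
  assumes "walk_distribution (1/2) P"
  shows "marginal P 3 0 = 1/4" "marginal P 2 0 = 1/4"
    and "marginal P 2 1 = 1/4" "marginal P 3 1 = 3/16"
proof -
  have init: "P 0 x 1 = 1/2 * (if x = 0 then 1 else 0)"
      "P 0 x (- 1) = 1/2 * (if x = 0 then 1 else 0)" for x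
    using assms by (auto simp: walk_distribution_def)
  have step: "P (Suc t) x 1 = 1/2 * P t (x - 1) 1 + 1/2 * P t x (- 1)"
      "P (Suc t) x (- 1) = 1/2 * P t (x + 1) (- 1) + 1/2 * P t x 1" for t x
    using assms by (auto simp: walk_distribution_def)
  show "marginal P 3 0 = 1/4" "marginal P 2 0 = 1/4"
    "marginal P 2 1 = 1/4" "marginal P 3 1 = 3/16"
    by (simp_all add: marginal_def numeral_2_eq_2 numeral_3_eq_3 step init)
qed

end

theory Submission
  imports Defs
begin

text \<open>
  Eliminating the direction from the recurrence gives, for the marginal, the second-order
  recurrence \<open>f\<^bsub>t+2\<^esub>(x) = p f\<^bsub>t+1\<^esub>(x-1) + p f\<^bsub>t+1\<^esub>(x+1) + (1 - 2 p) f\<^sub>t(x)\<close>. Its Green function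
  \<open>green p t x\<close>, started from the unit mass at 0, is the coefficient of \<open>z ^ t * w ^ x\<close> in
  \<open>1 / (1 - p (w + 1/w) z - (1 - 2 p) z\<^sup>2)\<close>, hence a Fibonacci polynomial in \<open>p (w + 1/w)\<close> and
  \<open>1 - 2 p\<close>, and so an explicit finite sum (lemma \<open>green_trinomial\<close>). The walk itself is a short
  linear combination of Green functions (lemma \<open>walk_distribution_green\<close>).

  The Green function lives on the sites with \<open>t + x\<close> even. For odd \<open>t + x\<close> the marginal at time \<open>t\<close> is
  therefore \<open>(1 - p) * green p (t - 1) x\<close> if \<open>t \<ge> 1\<close>, and for even \<open>t + x\<close> and \<open>t \<ge> 2\<close> it is
  \<open>(green p t x + (1 - 2 p) * green p (t - 2) x) / 2\<close>, a Lucas polynomial. Comparing coefficients, the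
  Green function at \<open>t = x + 2 m\<close> is \<open>p ^ x (1 - 2 p) ^ m\<close> times the Jacobi polynomial of degree \<open>m\<close> with
  parameters \<open>(x, 0)\<close> (lemma \<open>green_jacobi\<close>). This settles odd \<open>t + x\<close>. For even \<open>t + x\<close>, the
  contiguous relation between \<open>\<beta>\<close> and \<open>\<beta> + 1\<close> (lemma \<open>jacobi_poly_contiguous\<close>) turns the sum of two
  polynomials with \<open>\<beta> = 0\<close> into one with \<open>\<beta> = 1\<close>.

  For \<open>p = 1/2\<close> the term of second order disappears, and the Green function counts simple random
  walk paths by binomial coefficients.
\<close>

section \<open>Jacobi polynomials as finite sums\<close>

lemma gauss_2F1_terminating:
  assumes "m \<le> N"
  shows "gauss_2F1 (- real m) b c z =
    (\<Sum>k\<le>N. pochhammer (- real m) k * pochhammer b k / pochhammer c k * z ^ k / fact k)"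
  unfolding gauss_2F1_def
  using assms by (intro suminf_finite) (auto simp: pochhammer_of_nat_eq_0_iff)

text \<open>
  The coefficient is taken with respect to powers of \<open>z = (1 - y) / 2\<close>. It vanishes beyond the degree,
  so polynomials of different degree can be summed over one common range.
\<close>

definition jacobi_coeff :: "nat \<Rightarrow> real \<Rightarrow> real \<Rightarrow> nat \<Rightarrow> real" where
  "jacobi_coeff m \<alpha> \<beta> k =
     pochhammer (\<alpha> + 1) m / fact m * pochhammer (- real m) k
     * pochhammer (1 + \<alpha> + \<beta> + real m) k / (pochhammer (\<alpha> + 1) k * fact k)"

lemma jacobi_poly_sum:
  assumes "m \<le> N"
  shows "jacobi_poly m \<alpha> \<beta> y = (\<Sum>k\<le>N. jacobi_coeff m \<alpha> \<beta> k * ((1 - y) / 2) ^ k)"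
  unfolding jacobi_poly_def jacobi_coeff_def gauss_2F1_terminating[OF assms] sum_distrib_left
  by (intro sum.cong refl) (simp add: field_simps)

lemma jacobi_coeff_eq_0: "m < k \<Longrightarrow> jacobi_coeff m \<alpha> \<beta> k = 0"
  by (simp add: jacobi_coeff_def pochhammer_of_nat_eq_0_iff)

lemma jacobi_coeff_contiguous_0:
  "(2 * real m + 2 + \<alpha> + \<beta>) * jacobi_coeff m \<alpha> (\<beta> + 1) 0 =
     (real m + 1) * jacobi_coeff (Suc m) \<alpha> \<beta> 0 + (real m + \<beta> + 1) * jacobi_coeff m \<alpha> \<beta> 0"
proof -
  have "(real m + 1) * jacobi_coeff (Suc m) \<alpha> \<beta> 0 = (\<alpha> + real m + 1) * jacobi_coeff m \<alpha> \<beta> 0"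
    unfolding jacobi_coeff_def pochhammer_Suc fact_Suc
    by (simp add: divide_simps) (simp add: algebra_simps)
  moreover have "jacobi_coeff m \<alpha> (\<beta> + 1) 0 = jacobi_coeff m \<alpha> \<beta> 0"
    by (simp add: jacobi_coeff_def)
  ultimately show ?thesis by (simp add: algebra_simps)
qed

lemma jacobi_coeff_contiguous_Suc:
  assumes "\<alpha> > - 1"
  shows "(2 * real m + 2 + \<alpha> + \<beta>) * (jacobi_coeff m \<alpha> (\<beta> + 1) (Suc k) - jacobi_coeff m \<alpha> (\<beta> + 1) k) =
     (real m + 1) * jacobi_coeff (Suc m) \<alpha> \<beta> (Suc k)
     + (real m + \<beta> + 1) * jacobi_coeff m \<alpha> \<beta> (Suc k)"
proof -
  \<comment> \<open>The four coefficients are polynomial multiples of one common factor; dividing by it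
      leaves a polynomial identity in \<alpha>, \<beta>, m and k.\<close>
  define B where "B = pochhammer (\<alpha> + 1) m / fact m * pochhammer (- real m) k
     * pochhammer (2 + \<alpha> + \<beta> + real m) k / (pochhammer (\<alpha> + 1) (Suc k) * fact (Suc k))"
  have pos: "pochhammer (\<alpha> + 1) k > 0" "\<alpha> + 1 + real k > 0"
    using assms by (auto intro: pochhammer_pos)
  have args: "1 + \<alpha> + (\<beta> + 1) + real m = 2 + \<alpha> + \<beta> + real m"
    "1 + \<alpha> + \<beta> + real (Suc m) = 2 + \<alpha> + \<beta> + real m"
    "1 + \<alpha> + \<beta> + real m + 1 = 2 + \<alpha> + \<beta> + real m"
    "- real (Suc m) + 1 = - real m" "- real m + real k = real k - real m"
    by simp_all
  have c1: "jacobi_coeff m \<alpha> (\<beta> + 1) (Suc k) = B * ((real k - real m) * (2 + \<alpha> + \<beta> + real m + real k))"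
    unfolding jacobi_coeff_def B_def args pochhammer_Suc[of "- real m"]
      pochhammer_Suc[of "2 + \<alpha> + \<beta> + real m"]
    by (simp add: mult_ac)
  have c2: "jacobi_coeff m \<alpha> (\<beta> + 1) k = B * ((\<alpha> + 1 + real k) * (real k + 1))"
    unfolding jacobi_coeff_def B_def args pochhammer_Suc fact_Suc
    using pos by (simp add: divide_simps)
  have c3: "(real m + 1) * jacobi_coeff (Suc m) \<alpha> \<beta> (Suc k) =
      B * (- (\<alpha> + 1 + real m) * (real m + 1) * (2 + \<alpha> + \<beta> + real m + real k))"
    unfolding jacobi_coeff_def B_def pochhammer_rec[of "- real (Suc m)"] args
      pochhammer_Suc[of "2 + \<alpha> + \<beta> + real m"] pochhammer_Suc[of "\<alpha> + 1" m] fact_Suc[of m]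
    by (simp add: divide_simps) (simp add: algebra_simps)
  have c4: "jacobi_coeff m \<alpha> \<beta> (Suc k) = B * ((real k - real m) * (1 + \<alpha> + \<beta> + real m))"
    unfolding jacobi_coeff_def B_def pochhammer_Suc[of "- real m"]
      pochhammer_rec[of "1 + \<alpha> + \<beta> + real m"] args
    by (simp add: mult_ac)
  show ?thesis unfolding c1 c2 c3 c4 by algebra
qed

text \<open>
  This relation is what produces the factor \<open>(1 - p)\<^sup>2\<close> and the raised upper index in the formulas for
  even \<open>t + x\<close>: there the marginal is a sum of two Jacobi polynomials of consecutive degree. With
  \<open>1 + y = 2 (1 - z)\<close>, the left-hand side has differences of consecutive coefficients, so the relation
  reduces to the two coefficient identities above.
\<close>

lemma jacobi_poly_contiguous:
  assumes "\<alpha> > - 1"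
  shows "(2 * real m + 2 + \<alpha> + \<beta>) * ((1 + y) / 2) * jacobi_poly m \<alpha> (\<beta> + 1) y =
     (real m + 1) * jacobi_poly (Suc m) \<alpha> \<beta> y + (real m + \<beta> + 1) * jacobi_poly m \<alpha> \<beta> y"
proof -
  define z where "z = (1 - y) / 2"
  define c where "c = jacobi_coeff m \<alpha> (\<beta> + 1)"
  let ?K = "2 * real m + 2 + \<alpha> + \<beta>"
  define S where "S = (\<Sum>k\<le>Suc m. c k * z ^ k)"
  have z: "(1 + y) / 2 = 1 - z" by (simp add: z_def field_simps)
  have J: "jacobi_poly m \<alpha> (\<beta> + 1) y = S"
    by (simp add: S_def jacobi_poly_sum[of m "Suc m"] c_def z_def)
  have S: "S = c 0 + (\<Sum>k\<le>m. c (Suc k) * z ^ Suc k)"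
    unfolding S_def by (simp only: sum.atMost_Suc_shift) simp
  have zS: "z * S = (\<Sum>k\<le>m. c k * z ^ Suc k)"
    by (simp add: S_def c_def jacobi_coeff_eq_0 sum_distrib_left mult_ac)
  have "?K * ((1 + y) / 2) * jacobi_poly m \<alpha> (\<beta> + 1) y = ?K * (S - z * S)"
    unfolding z J by (simp add: algebra_simps)
  also have "\<dots> =
      ?K * c 0 + (\<Sum>k\<le>m. ?K * (c (Suc k) - c k) * z ^ Suc k)"
    unfolding zS unfolding S
    by (simp add: right_diff_distrib left_diff_distrib distrib_left sum_distrib_left sum_subtractf
        mult.assoc)
  also have "\<dots> = (\<Sum>k\<le>Suc m. ((real m + 1) * jacobi_coeff (Suc m) \<alpha> \<beta> k
      + (real m + \<beta> + 1) * jacobi_coeff m \<alpha> \<beta> k) * z ^ k)"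
    unfolding c_def jacobi_coeff_contiguous_0 jacobi_coeff_contiguous_Suc[OF assms]
    by (simp only: sum.atMost_Suc_shift) simp
  also have "\<dots> = (real m + 1) * jacobi_poly (Suc m) \<alpha> \<beta> y
      + (real m + \<beta> + 1) * jacobi_poly m \<alpha> \<beta> y"
    by (simp only: jacobi_poly_sum[of m "Suc m"] jacobi_poly_sum[of "Suc m" "Suc m"] z_def
        sum_distrib_left sum.distrib distrib_right mult.assoc le_SucI order_refl)
  finally show ?thesis .
qed

lemma pochhammer_nat_fact: "pochhammer (real x + 1) k = fact (x + k) / fact x"
proof -
  have "fact (x + k) = (fact x :: real) * pochhammer (real x + 1) k"
    using pochhammer_product'[of "1::real" x k] by (simp add: pochhammer_fact add.commute)
  then show ?thesis by simp
qed

text \<open>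
  For \<open>\<beta> = 0\<close> and integral \<open>\<alpha> = x\<close> the coefficient is, up to sign, the trinomial number
  \<open>(x + m + k)! / (k! (m - k)! (x + k)!)\<close>, which is written here as the product of two binomials in
  which it arises when counting paths.
\<close>

lemma jacobi_coeff_binomial:
  assumes "k \<le> m"
  shows "jacobi_coeff m (real x) 0 k =
    (- 1) ^ k * real ((x + m + k) choose (m - k)) * real ((x + 2 * k) choose k)"
proof -
  have "real m gchoose k = (- 1) ^ k * pochhammer (- real m) k / fact k"
    by (rule gbinomial_pochhammer)
  moreover have "real m gchoose k = fact m / (fact k * fact (m - k))"
    using binomial_fact[OF assms, where ?'a = real] by (simp add: binomial_gbinomial)
  ultimately have "(- 1) ^ k * ((- 1) ^ k * pochhammer (- real m) k) = (- 1) ^ k * fact m / fact (m - k)"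
    by (simp add: field_simps)
  then have neg: "pochhammer (- real m) k = (- 1) ^ k * fact m / fact (m - k)"
    by (simp flip: power_mult_distrib mult.assoc)
  have "pochhammer (1 + real x + 0 + real m) k = fact (x + m + k) / fact (x + m)"
    using pochhammer_nat_fact[of "x + m" k] by (simp add: add_ac)
  moreover have "real ((x + m + k) choose (m - k)) = fact (x + m + k) / (fact (m - k) * fact (x + 2 * k))"
    using assms by (simp add: binomial_fact mult_2)
  moreover have "real ((x + 2 * k) choose k) = fact (x + 2 * k) / (fact k * fact (x + k))"
    by (simp add: binomial_fact mult_2 add.assoc[symmetric])
  ultimately show ?thesis
    unfolding jacobi_coeff_def neg pochhammer_nat_fact by simp
qed

section \<open>Counting paths with unit steps\<close>

primrec unit_paths :: "nat \<Rightarrow> int \<Rightarrow> nat" where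
  "unit_paths 0 x = (if x = 0 then 1 else 0)"
| "unit_paths (Suc i) x = unit_paths i (x - 1) + unit_paths i (x + 1)"

lemma unit_paths_out_of_range: "int i < \<bar>x\<bar> \<Longrightarrow> unit_paths i x = 0"
  by (induction i arbitrary: x) auto

lemma unit_paths_odd: "odd (int i + x) \<Longrightarrow> unit_paths i x = 0"
  by (induction i arbitrary: x) auto

lemma unit_paths_binomial: "unit_paths (a + b) (int a - int b) = (a + b) choose a"
proof (induction "a + b" arbitrary: a b)
  case 0
  then show ?case by simp
next
  case (Suc i)
  consider "a = 0" "b = Suc i" | "b = 0" "a = Suc i"
    | a' b' where "a = Suc a'" "b = Suc b'" "i = a' + b" "i = a + b'"
    using Suc.hyps(2) by (cases a; cases b) auto
  then show ?case
  proof cases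
    case 1
    then show ?thesis using Suc.hyps(1)[of 0 i] by (simp add: unit_paths_out_of_range)
  next
    case 2
    then show ?thesis using Suc.hyps(1)[of i 0] by (simp add: unit_paths_out_of_range)
  next
    case 3
    have "a + b = Suc i" using Suc.hyps(2) by simp
    moreover have "int a - int b - 1 = int a' - int b" "int a - int b + 1 = int a - int b'"
      using 3(1,2) by simp_all
    moreover have "unit_paths i (int a' - int b) = i choose a'"
      using Suc.hyps(1)[OF 3(3)] 3(3) by simp
    moreover have "unit_paths i (int a - int b') = i choose a"
      using Suc.hyps(1)[OF 3(4)] 3(4) by simp
    ultimately show ?thesis by (simp only: unit_paths.simps) (simp add: 3(1))
  qed
qed

section \<open>The fundamental solution\<close>

text \<open>
  If \<open>h i = a ^ i\<close>, this is the Fibonacci polynomial \<open>F\<^bsub>t+1\<^esub>\<close> in \<open>a\<close> and \<open>r\<close>, that is, the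
  coefficient of \<open>z ^ t\<close> in \<open>1 / (1 - a z - r z\<^sup>2)\<close>. A general \<open>h\<close> allows \<open>a\<close> to be an operator: \<open>h i\<close>
  is then the value of its \<open>i\<close>-th power. Terms with \<open>2 * c > t\<close>, where \<open>t - 2 * c\<close> is truncated, have
  binomial factor 0.
\<close>

definition fib_sum :: "real \<Rightarrow> (nat \<Rightarrow> real) \<Rightarrow> nat \<Rightarrow> real" where
  "fib_sum r h t = (\<Sum>c\<le>t. real ((t - c) choose c) * r ^ c * h (t - 2 * c))"

text \<open>
  Pascal's rule for the binomial factor: one summand gives the term with \<open>r\<close>, the other one
  the term in which \<open>h\<close> is advanced by one power.
\<close>

lemma fib_sum_rec:
  "fib_sum r h (Suc (Suc t)) = fib_sum r (\<lambda>i. h (Suc i)) (Suc t) + r * fib_sum r h t"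
proof -
  have "fib_sum r h (Suc (Suc t)) = h (Suc (Suc t)) +
      (\<Sum>c\<le>t. real (Suc (t - c) choose Suc c) * r ^ Suc c * h (t - 2 * c))"
    unfolding fib_sum_def sum.atMost_Suc_shift[of _ "Suc t"]
    by (simp add: Suc_diff_le cong: sum.cong_simp)
  also have "\<dots> = h (Suc (Suc t)) +
      (\<Sum>c\<le>t. real ((t - c) choose Suc c) * r ^ Suc c * h (t - 2 * c)) + r * fib_sum r h t"
    by (simp add: fib_sum_def sum_distrib_left sum.distrib algebra_simps)
  also have "(\<Sum>c\<le>t. real ((t - c) choose Suc c) * r ^ Suc c * h (t - 2 * c)) =
      (\<Sum>c\<le>t. real ((t - c) choose Suc c) * r ^ Suc c * h (Suc (t - Suc (2 * c))))"
  proof (intro sum.cong refl)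
    fix c
    show "real ((t - c) choose Suc c) * r ^ Suc c * h (t - 2 * c) =
      real ((t - c) choose Suc c) * r ^ Suc c * h (Suc (t - Suc (2 * c)))"
    proof (cases "Suc (2 * c) \<le> t")
      case True
      then have "t - 2 * c = Suc (t - Suc (2 * c))" by simp
      then show ?thesis by simp
    qed (simp add: binomial_eq_0)
  qed
  also have "h (Suc (Suc t)) + \<dots> = fib_sum r (\<lambda>i. h (Suc i)) (Suc t)"
    unfolding fib_sum_def sum.atMost_Suc_shift[of _ t] by simp
  finally show ?thesis by simp
qed

text \<open>
  The Green function of the second-order recurrence that the walk satisfies once its direction is
  eliminated: the Fibonacci polynomial in the operator \<open>f \<mapsto> (\<lambda>x. p f (x - 1) + p f (x + 1))\<close> and
  in \<open>r = 1 - 2 p\<close>, applied to the unit mass at 0. The value \<open>r = (1 - p)\<^sup>2 - p\<^sup>2\<close> is minus the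
  determinant of the matrix of the one-step recurrence.
\<close>

definition green :: "real \<Rightarrow> nat \<Rightarrow> int \<Rightarrow> real" where
  "green p t x = fib_sum (1 - 2 * p) (\<lambda>i. p ^ i * real (unit_paths i x)) t"

lemma green_0: "green p 0 x = (if x = 0 then 1 else 0)"
  by (simp add: green_def fib_sum_def)

lemma green_1: "green p (Suc 0) x = p * green p 0 (x - 1) + p * green p 0 (x + 1)"
  by (simp add: green_def fib_sum_def)

lemma green_rec:
  "green p (Suc (Suc t)) x =
     p * green p (Suc t) (x - 1) + p * green p (Suc t) (x + 1) + (1 - 2 * p) * green p t x"
  unfolding green_def fib_sum_rec
  by (simp add: fib_sum_def sum_distrib_left sum.distrib algebra_simps)

text \<open>
  Every unit step changes the parity of the position, and the summation index lowers the number of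
  steps by two.
\<close>

lemma green_odd: "odd (int t + x) \<Longrightarrow> green p t x = 0"
  unfolding green_def fib_sum_def
proof (intro sum.neutral ballI)
  fix c assume odd: "odd (int t + x)"
  show "real ((t - c) choose c) * (1 - 2 * p) ^ c *
      (p ^ (t - 2 * c) * real (unit_paths (t - 2 * c) x)) = 0"
  proof (cases "2 * c \<le> t")
    case True
    then have "odd (int (t - 2 * c) + x)" using odd by (simp add: of_nat_diff)
    then show ?thesis by (simp add: unit_paths_odd)
  qed (simp add: binomial_eq_0)
qed

lemma green_out_of_range: "int t < \<bar>x\<bar> \<Longrightarrow> green p t x = 0"
  unfolding green_def fib_sum_def
  by (intro sum.neutral ballI) (auto simp: unit_paths_out_of_range)

text \<open>
  From the \<open>x + 2 * m - 2 * c\<close> unit steps, \<open>x\<close> lead to the right and the others cancel in pairs,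
  so that only \<open>c \<le> m\<close> contributes; \<open>k = m - c\<close> is the number of steps to the left.
\<close>

lemma green_trinomial:
  "green p (x + 2 * m) (int x) =
    (\<Sum>k\<le>m. real ((x + m + k) choose (m - k)) * real ((x + 2 * k) choose k)
        * p ^ (x + 2 * k) * (1 - 2 * p) ^ (m - k))"
proof -
  have "green p (x + 2 * m) (int x) = (\<Sum>c\<le>m. real ((x + 2 * m - c) choose c) * (1 - 2 * p) ^ c
      * (p ^ (x + 2 * m - 2 * c) * real (unit_paths (x + 2 * m - 2 * c) (int x))))"
    unfolding green_def fib_sum_def
    by (intro sum.mono_neutral_right) (auto simp: unit_paths_out_of_range)
  also have "\<dots> = (\<Sum>k\<le>m. real ((x + 2 * m - (m - k)) choose (m - k)) * (1 - 2 * p) ^ (m - k)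
      * (p ^ (x + 2 * m - 2 * (m - k)) * real (unit_paths (x + 2 * m - 2 * (m - k)) (int x))))"
    by (rule sum.reindex_bij_witness[of _ "\<lambda>k. m - k" "\<lambda>k. m - k"]) auto
  also have "\<dots> = (\<Sum>k\<le>m. real ((x + m + k) choose (m - k)) * real ((x + 2 * k) choose k)
        * p ^ (x + 2 * k) * (1 - 2 * p) ^ (m - k))"
  proof (intro sum.cong refl)
    fix k assume "k \<in> {..m}"
    then have e: "x + 2 * m - (m - k) = x + m + k" "x + 2 * m - 2 * (m - k) = x + 2 * k"
      by auto
    have "unit_paths (x + 2 * k) (int x) = (x + 2 * k) choose (x + k)"
      using unit_paths_binomial[of "x + k" k] by (simp add: mult_2 add.assoc)
    also have "\<dots> = (x + 2 * k) choose k"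
      using binomial_symmetric[of k "x + 2 * k"] by (simp add: algebra_simps mult_2)
    finally show "real ((x + 2 * m - (m - k)) choose (m - k)) * (1 - 2 * p) ^ (m - k)
      * (p ^ (x + 2 * m - 2 * (m - k)) * real (unit_paths (x + 2 * m - 2 * (m - k)) (int x))) =
      real ((x + m + k) choose (m - k)) * real ((x + 2 * k) choose k)
        * p ^ (x + 2 * k) * (1 - 2 * p) ^ (m - k)"
      unfolding e by simp
  qed
  finally show ?thesis .
qed

lemma green_jacobi:
  assumes "p \<noteq> 1 / 2"
  shows "green p (x + 2 * m) (int x) =
    p ^ x * (1 - 2 * p) ^ m * jacobi_poly m (real x) 0 (2 * p\<^sup>2 / (1 - 2 * p) + 1)"
proof -
  define r where "r = 1 - 2 * p"
  have r: "r \<noteq> 0" using assms by (simp add: r_def)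
  have z: "(1 - (2 * p\<^sup>2 / r + 1)) / 2 = - (p\<^sup>2 / r)" by simp
  show ?thesis
    unfolding green_trinomial jacobi_poly_sum[OF order_refl] sum_distrib_left r_def[symmetric] z
  proof (intro sum.cong refl)
    fix k assume "k \<in> {..m}"
    then have k: "k \<le> m" by simp
    have "r ^ m = r ^ (m - k) * r ^ k" using k by (simp flip: power_add)
    moreover have "(- (p\<^sup>2 / r)) ^ k = (- 1) ^ k * p ^ (2 * k) / r ^ k"
      by (simp add: power_minus[of "p\<^sup>2 / r"] power_divide power_mult)
    moreover have "(- 1) ^ k * (- 1 :: real) ^ k = 1" by (simp flip: power_mult_distrib)
    ultimately show "real ((x + m + k) choose (m - k)) * real ((x + 2 * k) choose k)
        * p ^ (x + 2 * k) * r ^ (m - k) =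
      p ^ x * r ^ m * (jacobi_coeff m (real x) 0 k * (- (p\<^sup>2 / r)) ^ k)"
      using r by (simp add: jacobi_coeff_binomial[OF k] power_add)
  qed
qed

text \<open>
  At \<open>p = 1/2\<close> the second-order term \<open>1 - 2 p\<close> vanishes, and only the free walk is left.
\<close>

lemma green_half: "green (1 / 2) t x = real (unit_paths t x) / 2 ^ t"
proof -
  have "green (1 / 2) t x = (\<Sum>c\<le>t. if c = 0 then real (unit_paths t x) / 2 ^ t else 0)"
    unfolding green_def fib_sum_def
    by (intro sum.cong refl) (auto simp: power_one_over divide_simps)
  then show ?thesis by simp
qed

section \<open>The marginal distribution\<close>

text \<open>
  In terms of generating functions, the one-step recurrence is a two by two linear system with
  determinant \<open>1 - p (w + 1/w) z - (1 - 2 p) z\<^sup>2\<close>, where \<open>w\<close> marks a shift by one to the right.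
  The formula is Cramer's rule: the numerator for direction \<open>d\<close> is
  \<open>1/2 (1 - p w\<^bsup>-d\<^esup> z + (1 - p) z)\<close>.
\<close>

lemma walk_distribution_green:
  assumes "walk_distribution p P" "d \<in> {- 1, 1}"
  shows "P (Suc t) x d =
    1/2 * (green p (Suc t) x - p * green p t (x + d) + (1 - p) * green p t x)"
  using assms(2)
proof (induction t arbitrary: x d)
  case 0
  have "P (Suc 0) x d = p * P 0 (x - d) d + (1 - p) * P 0 x (- d)"
    using assms(1) 0 by (auto simp: walk_distribution_def)
  moreover have "P 0 x' d' = 1/2 * green p 0 x'" if "d' \<in> {- 1, 1}" for x' d'
    using assms(1) that unfolding walk_distribution_def green_0 by blast
  then have "P 0 (x - d) d = 1/2 * green p 0 (x - d)" "P 0 x (- d) = 1/2 * green p 0 x"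
    using 0 by auto
  ultimately show ?case using 0 by (auto simp: green_1 field_simps)
next
  case (Suc t)
  have "P (Suc (Suc t)) x d = p * P (Suc t) (x - d) d + (1 - p) * P (Suc t) x (- d)"
    using assms(1) Suc.prems by (auto simp: walk_distribution_def)
  also have "P (Suc t) (x - d) d = 1/2 * (green p (Suc t) (x - d) - p * green p t x
      + (1 - p) * green p t (x - d))"
    using Suc.IH[of d "x - d"] Suc.prems by simp
  also have "P (Suc t) x (- d) = 1/2 * (green p (Suc t) x - p * green p t (x - d)
      + (1 - p) * green p t x)"
    using Suc.IH[of "- d" x] Suc.prems by auto
  finally show ?case
    using Suc.prems by (auto simp: green_rec field_simps)
qed

lemma marginal_green:
  assumes "walk_distribution p P"
  shows "marginal P (Suc t) x = green p (Suc t) x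
    - p / 2 * (green p t (x - 1) + green p t (x + 1)) + (1 - p) * green p t x"
  by (simp add: marginal_def walk_distribution_green[OF assms] algebra_simps)

text \<open>
  The marginal combines the Green function at times of both parities. At a given site one of the two
  parities vanishes, which separates the two families of formulas.
\<close>

lemma marginal_odd:
  assumes "walk_distribution p P" "even (int t + x)"
  shows "marginal P (Suc t) x = (1 - p) * green p t x"
  using assms(2) by (simp add: marginal_green[OF assms(1)] green_odd)

text \<open>
  This is the Lucas combination \<open>F\<^bsub>t+3\<^esub> + r F\<^bsub>t+1\<^esub>\<close> of Fibonacci polynomials, halved.
\<close>

lemma marginal_even:
  assumes "walk_distribution p P" "even (int t + x)"
  shows "marginal P (Suc (Suc t)) x = 1/2 * (green p (Suc (Suc t)) x + (1 - 2 * p) * green p t x)"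
  using assms(2) by (simp add: marginal_green[OF assms(1)] green_odd green_rec algebra_simps)

lemma marginal_odd_jacobi:
  assumes "walk_distribution p P" "p \<noteq> 1 / 2"
  shows "marginal P (x + 2 * m + 1) (int x) =
    (1 - p) * p ^ x * (1 - 2 * p) ^ m * jacobi_poly m (real x) 0 (2 * p\<^sup>2 / (1 - 2 * p) + 1)"
  using marginal_odd[OF assms(1), of "x + 2 * m" "int x"]
  by (simp add: green_jacobi[OF assms(2)])

text \<open>
  The two Green functions are Jacobi polynomials with \<open>\<beta> = 0\<close> of degrees \<open>m + 1\<close> and \<open>m\<close>. The
  contiguous relation contracts their sum to one polynomial with \<open>\<beta> = 1\<close>, at the price of the factor
  \<open>(1 + y) / 2\<close>, which equals \<open>(1 - p)\<^sup>2 / (1 - 2 p)\<close>.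
\<close>

lemma marginal_even_jacobi:
  assumes "walk_distribution p P" "p \<noteq> 1 / 2"
  shows "marginal P (x + 2 * m + 2) (int x) =
    (1 - p)\<^sup>2 * p ^ x * (1 - 2 * p) ^ m * ((real x / 2 + real m + 1) / (real m + 1))
    * jacobi_poly m (real x) 1 (2 * p\<^sup>2 / (1 - 2 * p) + 1)"
proof -
  define r where "r = 1 - 2 * p"
  define y where "y = 2 * p\<^sup>2 / r + 1"
  let ?J = "\<lambda>m b. jacobi_poly m (real x) b y"
  have r: "r \<noteq> 0" using assms(2) by (simp add: r_def)
  \<comment> \<open>uses \<open>1 - 2 p + p\<^sup>2 = (1 - p)\<^sup>2\<close>\<close>
  have sq: "(1 + y) / 2 = (1 - p)\<^sup>2 / r"
    using r by (simp add: y_def field_simps) (simp add: r_def power2_eq_square algebra_simps)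
  have "marginal P (x + 2 * m + 2) (int x) =
      1/2 * (green p (x + 2 * Suc m) (int x) + r * green p (x + 2 * m) (int x))"
    using marginal_even[OF assms(1), of "x + 2 * m" "int x"] by (simp add: r_def)
  also have "\<dots> = 1/2 * p ^ x * r ^ Suc m * (?J (Suc m) 0 + ?J m 0)"
    unfolding green_jacobi[OF assms(2)] r_def[symmetric] y_def[symmetric] by (simp add: algebra_simps)
  also have "?J (Suc m) 0 + ?J m 0 =
      (2 * real m + 2 + real x) * ((1 - p)\<^sup>2 / r) * ?J m 1 / (real m + 1)"
    using jacobi_poly_contiguous[of "real x" m 0 y]
    by (simp add: sq nonzero_eq_divide_eq algebra_simps)
  also have "1/2 * p ^ x * r ^ Suc m * \<dots> =
      (1 - p)\<^sup>2 * p ^ x * r ^ m * ((real x / 2 + real m + 1) / (real m + 1)) * ?J m 1"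
    using r by (simp add: divide_simps)
  finally show ?thesis by (simp add: r_def y_def)
qed

text \<open>
  A site is given by the numbers \<open>a\<close> and \<open>b\<close> of unit steps to the right and to the left.
\<close>

lemma marginal_odd_half:
  assumes "walk_distribution (1 / 2) P"
  shows "marginal P (a + b + 1) (int a - int b) = real ((a + b) choose a) / 2 ^ (a + b + 1)"
proof -
  have "even (int (a + b) + (int a - int b))" by simp
  from marginal_odd[OF assms this] show ?thesis
    by (simp add: green_half unit_paths_binomial)
qed

lemma marginal_even_half:
  assumes "walk_distribution (1 / 2) P" "a + b \<ge> 2"
  shows "marginal P (a + b) (int a - int b) = real ((a + b) choose a) / 2 ^ (a + b + 1)"
proof -
  obtain t where t: "a + b = Suc (Suc t)"
    using assms(2) by (metis add_2_eq_Suc le_Suc_ex)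
  have "even (int (Suc (Suc t)) + (int a - int b))" unfolding t[symmetric] by simp
  then have "even (int t + (int a - int b))" by simp
  from marginal_even[OF assms(1) this] show ?thesis
    unfolding t[symmetric] by (simp add: green_half unit_paths_binomial)
qed

lemma marginal_diagonal:
  assumes "walk_distribution p P" "n \<ge> 1"
  shows "marginal P n (int n) = 1/2 * p ^ n"
proof -
  obtain t where n: "n = Suc t" using assms(2) by (cases n) auto
  have diag: "green p i (int i) = p ^ i" for i
    using green_trinomial[of p i 0] by simp
  have "green p t (int n) = 0" "green p t (int n + 1) = 0"
    by (rule green_out_of_range; simp add: n)+
  then show ?thesis
    using diag[of n] diag[of t] marginal_green[OF assms(1), of t "int n"] by (simp add: n)
qed

text \<open>
  Reflecting the line together with the direction preserves the recurrence and the initial values.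
\<close>

lemma marginal_symmetric:
  assumes "walk_distribution p P"
  shows "marginal P t (- x) = marginal P t x"
proof -
  have "P t (- x) (- d) = P t x d" if "d \<in> {- 1, 1}" for d
    using that
  proof (induction t arbitrary: x d)
    case 0
    have init: "P 0 x' d' = 1/2 * (if x' = 0 then 1 else 0)" if "d' \<in> {- 1, 1}" for x' d'
      using assms that unfolding walk_distribution_def by blast
    show ?case using init[of "- d" "- x"] init[of d x] 0 by auto
  next
    case (Suc t)
    have step: "P (Suc t) x' d' = p * P t (x' - d') d' + (1 - p) * P t x' (- d')"
      if "d' \<in> {- 1, 1}" for x' d'
      using assms that unfolding walk_distribution_def by blast
    have "- d \<in> {- 1, 1}" using Suc.prems by auto
    note step[OF Suc.prems, of x] step[OF this, of "- x"]
    moreover have "- x - (- d) = - (x - d)" by simp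
    moreover have "P t (- (x - d)) (- d) = P t (x - d) d" "P t (- x) (- (- d)) = P t x (- d)"
      using Suc.IH[of d "x - d"] Suc.IH[of "- d" x] Suc.prems by auto
    ultimately show ?case by presburger
  qed
  from this[of 1] this[of "- 1"] show ?thesis by (simp add: marginal_def)
qed

section \<open>The closed forms\<close>

theorem theorem5p1:
  fixes p :: real and P :: "nat \<Rightarrow> int \<Rightarrow> int \<Rightarrow> real" and n :: nat
  assumes "0 < p" and "p < 1"
    and "walk_distribution p P"
    and "n \<ge> 1"
  shows
    "(p \<noteq> 1/2 \<longrightarrow>
       (let y = 2 * p\<^sup>2 / (1 - 2 * p) + 1 in
         (\<forall>j::nat. j \<le> n \<longrightarrow>
            marginal P (2 * n + 1) (2 * int j) =
              (1 - p) * p ^ (2 * j) * (1 - 2 * p) ^ (n - j)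
              * jacobi_poly (n - j) (2 * real j) 0 y) \<and>
         (\<forall>j::nat. j \<le> n - 1 \<longrightarrow>
            marginal P (2 * n) (2 * int j) =
              (1 - p)\<^sup>2 * p ^ (2 * j) * (1 - 2 * p) ^ (n - j - 1) * (real n / real (n - j))
              * jacobi_poly (n - j - 1) (2 * real j) 1 y) \<and>
         (\<forall>j::nat. j \<le> n - 1 \<longrightarrow>
            marginal P (2 * n) (2 * int j + 1) =
              (1 - p) * p ^ (2 * j + 1) * (1 - 2 * p) ^ (n - j - 1)
              * jacobi_poly (n - j - 1) (2 * real j + 1) 0 y) \<and>
         (\<forall>j::nat. j \<le> n - 1 \<longrightarrow>
            marginal P (2 * n + 1) (2 * int j + 1) =
              (1 - p)\<^sup>2 * p ^ (2 * j + 1) * (1 - 2 * p) ^ (n - j - 1)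
              * ((real n + 1/2) / real (n - j))
              * jacobi_poly (n - j - 1) (2 * real j + 1) 1 y)))
     \<and>
     (marginal P n (int n) = 1/2 * p ^ n \<and>
      (\<forall>(t::nat) (x::int). marginal P t (- x) = marginal P t x))
     \<and>
     (p = 1/2 \<longrightarrow>
        (\<forall>j::nat. j \<le> n \<longrightarrow>
           marginal P (2 * n + 1) (2 * int j) =
             2 powi (- 2 * int n - 1) * real ((2 * n) choose (n + j))) \<and>
        (\<forall>j::nat. j \<le> n - 1 \<longrightarrow>
           marginal P (2 * n) (2 * int j) =
             2 powi (- 2 * int n - 1) * real ((2 * n) choose (n + j))) \<and>
        (\<forall>j::nat. j \<le> n - 1 \<longrightarrow>
           marginal P (2 * n) (2 * int j + 1) =
             2 powi (- 2 * int n) * real ((2 * n - 1) choose (n + j))) \<and>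
        (\<forall>j::nat. j \<le> n - 1 \<longrightarrow>
           marginal P (2 * n + 1) (2 * int j + 1) =
             2 powi (- 2 * int n - 2) * real ((2 * n + 1) choose (n + j + 1))))"
proof -
  note wd = assms(3)
  have a1: "marginal P (2 * n + 1) (2 * int j) =
      (1 - p) * p ^ (2 * j) * (1 - 2 * p) ^ (n - j)
      * jacobi_poly (n - j) (2 * real j) 0 (2 * p\<^sup>2 / (1 - 2 * p) + 1)"
    if "j \<le> n" "p \<noteq> 1/2" for j
    using marginal_odd_jacobi[OF wd that(2), of "2 * j" "n - j"] that(1)
    by (simp flip: distrib_left)
  have a2: "marginal P (2 * n) (2 * int j) =
      (1 - p)\<^sup>2 * p ^ (2 * j) * (1 - 2 * p) ^ (n - j - 1) * (real n / real (n - j))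
      * jacobi_poly (n - j - 1) (2 * real j) 1 (2 * p\<^sup>2 / (1 - 2 * p) + 1)"
    if "j \<le> n - 1" "p \<noteq> 1/2" for j
  proof -
    define m where "m = n - j - 1"
    have n: "n = j + m + 1" "n - j - 1 = m" "n - j = m + 1" using that(1) \<open>n \<ge> 1\<close> by (auto simp: m_def)
    show ?thesis unfolding n(2,3)
      using marginal_even_jacobi[OF wd that(2), of "2 * j" m] by (simp add: n(1) algebra_simps)
  qed
  have a3: "marginal P (2 * n) (2 * int j + 1) =
      (1 - p) * p ^ (2 * j + 1) * (1 - 2 * p) ^ (n - j - 1)
      * jacobi_poly (n - j - 1) (2 * real j + 1) 0 (2 * p\<^sup>2 / (1 - 2 * p) + 1)"
    if "j \<le> n - 1" "p \<noteq> 1/2" for j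
  proof -
    define m where "m = n - j - 1"
    have n: "n = j + m + 1" "n - j - 1 = m" using that(1) \<open>n \<ge> 1\<close> by (auto simp: m_def)
    show ?thesis unfolding n(2)
      using marginal_odd_jacobi[OF wd that(2), of "2 * j + 1" m] by (simp add: n(1) algebra_simps)
  qed
  have a4: "marginal P (2 * n + 1) (2 * int j + 1) =
      (1 - p)\<^sup>2 * p ^ (2 * j + 1) * (1 - 2 * p) ^ (n - j - 1) * ((real n + 1/2) / real (n - j))
      * jacobi_poly (n - j - 1) (2 * real j + 1) 1 (2 * p\<^sup>2 / (1 - 2 * p) + 1)"
    if "j \<le> n - 1" "p \<noteq> 1/2" for j
  proof -
    define m where "m = n - j - 1"
    have n: "n = j + m + 1" "n - j - 1 = m" "n - j = m + 1" using that(1) \<open>n \<ge> 1\<close> by (auto simp: m_def)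
    have "real (2 * j + 1) / 2 + real m + 1 = real n + 1/2" by (simp add: n(1) field_simps)
    moreover have "2 * j + 1 + 2 * m + 2 = 2 * n + 1" by (simp add: n(1))
    moreover have "real (2 * j + 1) = 2 * real j + 1" "int (2 * j + 1) = 2 * int j + 1"
      "real (m + 1) = real m + 1" by simp_all
    ultimately show ?thesis unfolding n(3) add_diff_cancel_right'
      using marginal_even_jacobi[OF wd that(2), of "2 * j + 1" m] by metis
  qed
  have powi: "2 powi i = 1 / (2::real) ^ k" if "i = - int k" for i k
    using that by (simp add: power_int_minus field_simps)
  have powi0: "2 powi (- 2 * int n) = 1 / (2::real) ^ (2 * n)"
    and powi1: "2 powi (- 2 * int n - 1) = 1 / (2::real) ^ (2 * n + 1)"
    and powi2: "2 powi (- 2 * int n - 2) = 1 / (2::real) ^ (2 * n + 2)"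
    by (rule powi; simp)+
  have c1: "marginal P (2 * n + 1) (2 * int j) =
      2 powi (- 2 * int n - 1) * real ((2 * n) choose (n + j))" if "j \<le> n" "p = 1/2" for j
    using marginal_odd_half[OF wd[unfolded that(2)], of "n + j" "n - j"] that(1)
    unfolding powi1 by (simp flip: mult_2)
  have c2: "marginal P (2 * n) (2 * int j) =
      2 powi (- 2 * int n - 1) * real ((2 * n) choose (n + j))" if "j \<le> n - 1" "p = 1/2" for j
    using marginal_even_half[OF wd[unfolded that(2)], of "n + j" "n - j"] that(1)
      \<open>n \<ge> 1\<close>
    unfolding powi1 by (simp flip: mult_2)
  have c3: "marginal P (2 * n) (2 * int j + 1) =
      2 powi (- 2 * int n) * real ((2 * n - 1) choose (n + j))" if "j \<le> n - 1" "p = 1/2" for j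
  proof -
    have "n + j + (n - 1 - j) = 2 * n - 1" "2 * n - 1 + 1 = 2 * n"
      "int (n + j) - int (n - 1 - j) = 2 * int j + 1" using that(1) \<open>n \<ge> 1\<close> by auto
    then show ?thesis
      using marginal_odd_half[OF wd[unfolded that(2)], of "n + j" "n - 1 - j"]
      unfolding powi0 by simp
  qed
  have c4: "marginal P (2 * n + 1) (2 * int j + 1) =
      2 powi (- 2 * int n - 2) * real ((2 * n + 1) choose (n + j + 1))"
    if "j \<le> n - 1" "p = 1/2" for j
  proof -
    have eqs: "n + j + 1 + (n - j) = 2 * n + 1"
      "int (n + j + 1) - int (n - j) = 2 * int j + 1" using that(1) \<open>n \<ge> 1\<close> by auto
    then show ?thesis
      using marginal_even_half[OF wd[unfolded that(2)], of "n + j + 1" "n - j"]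
        \<open>n \<ge> 1\<close> unfolding powi2 eqs by simp
  qed
  show ?thesis
    unfolding Let_def
    using a1 a2 a3 a4 c1 c2 c3 c4 marginal_diagonal[OF wd assms(4)] marginal_symmetric[OF wd]
    by blast
qed

end
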